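(* Let $n$ and $k$ be positive integers with $2\leq k\leq n-2$, and let $K_n^{(k)}$ be the complete $k$-uniform hypergraph on $n$ vertices. Then its convex dimension is $$\mathsf{cd}(K_n^{(k)})=\begin{cases}2k &\text{if } n\geq 2k+2,\\ n-2 &\text{if } n\in\{2k-1,2k,2k+1\},\\ 2n-2k &\text{if } n\leq 2k-2.\end{cases}$$ Moreover, $\mathsf{cd}(K_2^{(1)})=1$, and $\mathsf{cd}(K_n^{(1)})=\mathsf{cd}(K_n^{(n-1)})=2$ for every $n\geq 3$.
   Context: A $k$-uniform hypergraph is a pair $H=(V,E)$ with $V$ a finite set and $E\subseteq\binom{V}{k}$ (the set of $k$-element subsets of $V$). A convex embedding of $H$ into $\mathbb{R}^d$ is an injective map $f:V\to\mathbb{R}^d$ such that the points $\frac1k\sum_{v\in e}f(v)$, indexed by the hyperedges $e\in E$, are in convex position, i.e. the points indexed by different hyperedges are distinct and none of them is a convex combination of the others. The convex dimension $\mathsf{cd}(H)$ is the minimal $d$ for which a convex embedding of $H$ into $\mathbb{R}^d$ exists. The complete $k$-uniform hypergraph on $n$ vertices is $K_n^{(k)}=([n],\binom{[n]}{k})$ with $[n]=\{1,\dots,n\}$. *)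

theory Defs
  imports
    "HOL-Analysis.Analysis"
    "HOL-Analysis.Finite_Function_Topology"
    "HOL-Library.Ramsey"
begin

type_synonym 'v hypergraph = "'v set \<times> 'v set set"

fun uniform_hypergraph :: "nat \<Rightarrow> 'v hypergraph \<Rightarrow> bool" where
  "uniform_hypergraph k (V, E) \<longleftrightarrow> finite V \<and> E \<subseteq> [V]\<^bsup>k\<^esup>"

definition complete_hypergraph :: "nat \<Rightarrow> nat \<Rightarrow> nat hypergraph" where
  "complete_hypergraph n k = ({1..n}, [{1..n}]\<^bsup>k\<^esup>)"

text \<open>
  The dimension has to range over the natural numbers, so the spaces \<open>\<real>\<^sup>d\<close> are taken
  inside one real vector space, that of the finitely supported real sequences.
  Coordinates are numbered \<open>0, \<dots>, d - 1\<close>, and \<open>Rn 0\<close> consists of the origin only.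
\<close>

definition Rn :: "nat \<Rightarrow> (nat \<Rightarrow>\<^sub>0 real) set" where
  "Rn d = {x. \<forall>i\<ge>d. Poly_Mapping.lookup x i = 0}"

definition convex_position :: "('i \<Rightarrow> 'a::real_vector) \<Rightarrow> 'i set \<Rightarrow> bool" where
  "convex_position p I \<longleftrightarrow> inj_on p I \<and> (\<forall>i\<in>I. p i \<notin> convex hull (p ` (I - {i})))"

fun convex_embedding :: "nat \<Rightarrow> 'v hypergraph \<Rightarrow> nat \<Rightarrow> ('v \<Rightarrow> (nat \<Rightarrow>\<^sub>0 real)) \<Rightarrow> bool" where
  "convex_embedding k (V, E) d f \<longleftrightarrow>
     f ` V \<subseteq> Rn d \<and> inj_on f V \<and>
     convex_position (\<lambda>e. (1 / real k) *\<^sub>R (\<Sum>v\<in>e. f v)) E"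

text \<open>
  \<open>LEAST\<close> is unspecified on an empty set of dimensions; \<open>ex_convex_embedding\<close> below
  shows that this never happens for uniform hypergraphs.
\<close>

definition convex_dimension :: "nat \<Rightarrow> 'v hypergraph \<Rightarrow> nat" where
  "convex_dimension k H = (LEAST d. \<exists>f. convex_embedding k H d f)"

lemma uniform_complete_hypergraph: "uniform_hypergraph k (complete_hypergraph n k)"
  by (simp add: complete_hypergraph_def)

lemma lookup_scaleR: "Poly_Mapping.lookup (r *\<^sub>R x) i = r *\<^sub>R Poly_Mapping.lookup x i"
proof -
  have "finite {i. r *\<^sub>R Poly_Mapping.lookup x i \<noteq> 0}"
    by (rule finite_subset[OF _ finite_lookup[of x]]) auto
  then show ?thesis
    by (simp add: scaleR_poly_mapping_def)
qed

lemma ex_convex_embedding: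
  assumes "uniform_hypergraph k H" and "k > 0"
  shows "\<exists>d f. convex_embedding k H d f"
proof -
  obtain V E where H: "H = (V, E)" by (cases H)
  have V: "finite V" and E: "\<And>e. e \<in> E \<Longrightarrow> e \<subseteq> V \<and> finite e \<and> card e = k"
    using assms(1) by (auto simp: H nsets_def)
  obtain g :: "_ \<Rightarrow> nat" where g: "bij_betw g V {0..<card V}"
    using ex_bij_betw_finite_nat[OF V] by blast
  define f where "f v = Poly_Mapping.single (g v) (1::real)" for v
  have ginj: "inj_on g V" using g by (simp add: bij_betw_def)
  have glt: "g v < card V" if "v \<in> V" for v
    using g that by (auto simp: bij_betw_def)
  define p where "p e = (1 / real k) *\<^sub>R (\<Sum>v\<in>e. f v)" for e
  define h where "h e x = (\<Sum>v\<in>e. Poly_Mapping.lookup x (g v))" for e and x :: "nat \<Rightarrow>\<^sub>0 real"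
  have hadd: "h e (x + y) = h e x + h e y" and hsc: "h e (r *\<^sub>R x) = r * h e x" for e x y r
    by (simp_all add: h_def lookup_add lookup_scaleR sum.distrib sum_distrib_left)
  have hp: "h e (p e') = real (card (e \<inter> e')) / real k" if "e \<in> E" "e' \<in> E" for e e'
  proof -
    have eq: "Poly_Mapping.lookup (f w) (g v) = (if w = v then 1 else 0)"
      if "v \<in> e" "w \<in> e'" for v w
      using that E[OF \<open>e \<in> E\<close>] E[OF \<open>e' \<in> E\<close>] ginj
      by (auto simp: f_def lookup_single when_def inj_on_def)
    have "h e (p e') = (\<Sum>v\<in>e. (1 / real k) * (\<Sum>w\<in>e'. Poly_Mapping.lookup (f w) (g v)))"
      by (simp add: h_def p_def lookup_scaleR lookup_sum)
    also have "\<dots> = (\<Sum>v\<in>e. (1 / real k) * (if v \<in> e' then 1 else 0))"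
      using E[OF \<open>e' \<in> E\<close>] by (intro sum.cong refl arg_cong2[where f="(*)"]) (simp add: eq)
    also have "\<dots> = real (card (e \<inter> e')) / real k"
      using E[OF \<open>e \<in> E\<close>]
      by (simp flip: sum_distrib_left sum_divide_distrib add: sum.If_cases Int_def)
    finally show ?thesis .
  qed
  have lt: "h e (p e') < 1" if "e \<in> E" "e' \<in> E" "e' \<noteq> e" for e e'
  proof -
    have "e \<inter> e' \<subset> e"
      using that E[OF that(1)] E[OF that(2)] by (metis card_subset_eq inf.cobounded1 inf.absorb_iff1 psubsetI)
    then have "card (e \<inter> e') < k" using E[OF that(1)] psubset_card_mono by metis
    then show ?thesis using hp[OF that(1,2)] by simp
  qed
  have one: "h e (p e) = 1" if "e \<in> E" for e
    using hp[OF that that] E[OF that] assms(2) by simp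
  have "p e \<notin> convex hull (p ` (E - {e}))" if e: "e \<in> E" for e
  proof
    have "convex {x. h e x < 1}"
    proof (rule convexI)
      fix x y :: "nat \<Rightarrow>\<^sub>0 real" and u v :: real
      assume "x \<in> {x. h e x < 1}" "y \<in> {x. h e x < 1}" "0 \<le> u" "0 \<le> v" "u + v = 1"
      then have "u * h e x + v * h e y < 1" by (intro convex_bound_lt) auto
      then show "u *\<^sub>R x + v *\<^sub>R y \<in> {x. h e x < 1}" by (simp add: hadd hsc)
    qed
    then have "convex hull (p ` (E - {e})) \<subseteq> {x. h e x < 1}"
      using lt e by (intro hull_minimal) auto
    moreover assume "p e \<in> convex hull (p ` (E - {e}))"
    ultimately show False using one[OF e] by auto
  qed
  moreover have "inj_on p E"
    by (rule inj_onI) (metis lt one less_irrefl)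
  moreover have "f ` V \<subseteq> Rn (card V)"
    using glt by (auto simp: Rn_def f_def lookup_single when_def dest!: leD)
  moreover have "inj_on f V"
  proof (rule inj_onI)
    fix v w assume "v \<in> V" "w \<in> V" "f v = f w"
    then have "Poly_Mapping.lookup (f v) (g v) = Poly_Mapping.lookup (f w) (g v)" by simp
    then have "g v = g w" by (auto simp: f_def lookup_single when_def split: if_splits)
    then show "v = w" using ginj \<open>v \<in> V\<close> \<open>w \<in> V\<close> by (auto dest: inj_onD)
  qed
  ultimately have "convex_embedding k H (card V) f"
    by (simp add: H convex_position_def p_def[abs_def])
  then show ?thesis by blast
qed

end

theory Submission
  imports Defs
begin

text \<open>
  The barycenters of all \<open>k\<close>-subsets of \<open>n\<close> points are in convex position iff every \<open>k\<close>-subset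
  can be strictly separated from its complement by a hyperplane, which fails iff the points
  satisfy a nontrivial affine dependency with at most \<open>k\<close> positive and at most \<open>n - k\<close> negative
  coefficients. Up to negating dependencies, \<open>k\<close> and \<open>n - k\<close> play the same role. Separated
  configurations are given by points on the moment curve in dimensions \<open>2 k\<close> and \<open>2 (n - k)\<close>,
  and by a simplex with an interior point in dimension \<open>n - 2\<close>. Conversely, \<open>d + 3\<close> points in
  dimension \<open>d\<close> have a plane of dependencies, and a connectedness argument on a circle in it
  yields the required signs.
\<close>

section \<open>Affine dependencies obstruct convex position\<close>

text \<open>After scaling, the dependency says that the positive and the negative part have a common
  weighted mean \<open>X\<close>. Take a \<open>k\<close>-set \<open>A\<close> that contains the
  positive part and avoids the negative one. Exchanging \<open>i\<close> in the positive part for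
  \<open>j\<close> in the negative part moves the barycenter of \<open>A\<close> by
  \<open>(f j - f i) / k\<close>. Averaged over all such exchanges with product weights, the
  displacement is \<open>(X - X) / k\<close>, so the barycenter of \<open>A\<close> is a convex
  combination of the others.\<close>

lemma not_convex_position_if_dependency:
  fixes f :: "'v \<Rightarrow> 'a::real_vector"
  assumes V: "finite V"
    and sum0: "sum l V = 0" and comb0: "(\<Sum>v\<in>V. l v *\<^sub>R f v) = 0"
    and nz: "\<exists>v\<in>V. l v \<noteq> 0"
    and pos: "card {v\<in>V. l v > 0} \<le> k" and neg: "card {v\<in>V. l v < 0} + k \<le> card V"
  shows "\<not> convex_position (\<lambda>e. (1 / real k) *\<^sub>R (\<Sum>v\<in>e. f v)) ([V]\<^bsup>k\<^esup>)"
proof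
  define p where "p e = (1 / real k) *\<^sub>R (\<Sum>v\<in>e. f v)" for e
  assume "convex_position (\<lambda>e. (1 / real k) *\<^sub>R (\<Sum>v\<in>e. f v)) ([V]\<^bsup>k\<^esup>)"
  then have cp: "convex_position p ([V]\<^bsup>k\<^esup>)" by (simp add: p_def[abs_def])
  define P where "P = {v\<in>V. l v > 0}"
  define N where "N = {v\<in>V. l v < 0}"
  have fin: "finite P" "finite N" and sub: "P \<subseteq> V - N" "N \<subseteq> V"
    using V by (auto simp: P_def N_def)
  have split: "(\<Sum>v\<in>V. g v) = sum g P + sum g N" if "\<And>v. l v = 0 \<Longrightarrow> g v = 0"
    for g :: "'v \<Rightarrow> 'b::ab_group_add"
  proof -
    have "g v = 0" if "v \<in> V - (P \<union> N)" for v
      using that \<open>\<And>v. l v = 0 \<Longrightarrow> g v = 0\<close> linorder_neqE[of "l v" 0] by (auto simp: P_def N_def)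
    then have "(\<Sum>v\<in>V. g v) = sum g (P \<union> N)"
      using V sub fin by (intro sum.mono_neutral_right) auto
    also have "\<dots> = sum g P + sum g N"
      using fin sub by (intro sum.union_disjoint) auto
    finally show ?thesis .
  qed
  define c where "c = sum l P"
  have cN: "sum l N = - c" using split[of l] sum0 by (simp add: c_def)
  have lP: "l v > 0" if "v \<in> P" for v using that by (simp add: P_def)
  have lN: "l v < 0" if "v \<in> N" for v using that by (simp add: N_def)
  have c: "c > 0"
  proof (cases "P = {}")
    case True
    then have "N \<noteq> {}" using nz by (force simp: P_def N_def)
    then have "(\<Sum>v\<in>N. - l v) > 0" using fin lN by (intro sum_pos) auto
    then show ?thesis using cN by (simp add: sum_negf)
  next
    case False
    then show ?thesis unfolding c_def using fin lP by (intro sum_pos) auto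
  qed
  then have "P \<noteq> {}" by (auto simp: c_def)
  have "card (V - N) = card V - card N" using sub fin V by (simp add: card_Diff_subset)
  then have "k \<le> card (V - N)" "card P \<le> k" using pos neg unfolding P_def N_def by linarith+
  then obtain A where A: "P \<subseteq> A" "A \<subseteq> V - N" "card A = k"
    using exists_subset_between[of P k "V - N"] sub V by blast
  have finA: "finite A" using A V finite_subset by blast
  have k: "k > 0" using A \<open>P \<noteq> {}\<close> finA by (auto simp: card_gt_0_iff)
  have AV: "A \<in> [V]\<^bsup>k\<^esup>" using A finA by (auto simp: nsets_def)
  define C where "C = convex hull (p ` ([V]\<^bsup>k\<^esup> - {A}))"
  have C: "convex C" by (simp add: C_def)
  define swap where "swap i j = insert j (A - {i})" for i j
  have swap_in: "p (swap i j) \<in> C" if "i \<in> P" "j \<in> N" for i j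
  proof -
    have "i \<in> A" "j \<notin> A" "j \<in> V" using that A sub by auto
    then have "swap i j \<in> [V]\<^bsup>k\<^esup>" "swap i j \<noteq> A"
      using A finA k by (auto simp: nsets_def swap_def)
    then show ?thesis unfolding C_def by (intro hull_inc) auto
  qed
  have p_swap: "p (swap i j) = p A + (1 / real k) *\<^sub>R (f j - f i)" if "i \<in> P" "j \<in> N" for i j
  proof -
    have "i \<in> A" "j \<notin> A" using that A by auto
    then have "sum f (swap i j) = sum f A + (f j - f i)"
      using finA by (simp add: swap_def sum_diff1)
    then show ?thesis by (simp only: p_def scaleR_add_right)
  qed
  define X where "X = (\<Sum>j\<in>N. (- l j / c) *\<^sub>R f j)"
  have oneN: "(\<Sum>j\<in>N. - l j / c) = 1" and oneP: "(\<Sum>i\<in>P. l i / c) = 1"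
    using cN c by (simp_all add: sum_negf flip: sum_divide_distrib c_def)
  have XP: "(\<Sum>i\<in>P. (l i / c) *\<^sub>R f i) = X"
  proof -
    have "(\<Sum>i\<in>P. l i *\<^sub>R f i) = - (\<Sum>j\<in>N. l j *\<^sub>R f j)"
      using split[of "\<lambda>v. l v *\<^sub>R f v"] comb0 by (simp add: eq_neg_iff_add_eq_0)
    then have "(1 / c) *\<^sub>R (\<Sum>i\<in>P. l i *\<^sub>R f i) = (1 / c) *\<^sub>R (- (\<Sum>j\<in>N. l j *\<^sub>R f j))"
      by simp
    then show ?thesis by (simp add: X_def scaleR_sum_right sum_negf)
  qed
  \<comment> \<open>First average over \<open>j\<close> with \<open>i\<close> fixed; the average
    over \<open>i\<close> follows and cancels \<open>X\<close>.\<close>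
  have "p A + (1 / real k) *\<^sub>R (X - f i) \<in> C" if i: "i \<in> P" for i
  proof -
    have "(\<Sum>j\<in>N. (- l j / c) *\<^sub>R p (swap i j)) \<in> C"
      using fin C oneN swap_in[OF i] c lN by (intro convex_sum) (auto simp: divide_simps less_imp_le)
    also have "(\<Sum>j\<in>N. (- l j / c) *\<^sub>R p (swap i j))
      = (\<Sum>j\<in>N. (- l j / c) *\<^sub>R (p A - (1 / real k) *\<^sub>R f i) + (1 / real k) *\<^sub>R ((- l j / c) *\<^sub>R f j))"
      using i by (intro sum.cong refl) (simp add: p_swap algebra_simps)
    also have "\<dots> = (\<Sum>j\<in>N. - l j / c) *\<^sub>R (p A - (1 / real k) *\<^sub>R f i) + (1 / real k) *\<^sub>R X"
      unfolding X_def sum.distrib scaleR_sum_left scaleR_sum_right ..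
    also have "\<dots> = p A + (1 / real k) *\<^sub>R (X - f i)"
      unfolding oneN by (simp add: algebra_simps)
    finally show ?thesis .
  qed
  then have "(\<Sum>i\<in>P. (l i / c) *\<^sub>R (p A + (1 / real k) *\<^sub>R (X - f i))) \<in> C"
    using fin C oneP c lP by (intro convex_sum) (auto simp: less_imp_le)
  also have "(\<Sum>i\<in>P. (l i / c) *\<^sub>R (p A + (1 / real k) *\<^sub>R (X - f i)))
    = (\<Sum>i\<in>P. (l i / c) *\<^sub>R (p A + (1 / real k) *\<^sub>R X) - (1 / real k) *\<^sub>R ((l i / c) *\<^sub>R f i))"
    by (intro sum.cong refl) (simp add: algebra_simps)
  also have "\<dots> = (\<Sum>i\<in>P. l i / c) *\<^sub>R (p A + (1 / real k) *\<^sub>R X)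
      - (1 / real k) *\<^sub>R (\<Sum>i\<in>P. (l i / c) *\<^sub>R f i)"
    unfolding sum_subtractf scaleR_sum_left scaleR_sum_right ..
  also have "\<dots> = p A" unfolding oneP XP by simp
  finally have "p A \<in> C" .
  then show False using cp AV by (auto simp: convex_position_def C_def)
qed

section \<open>Separation of vertex sets gives convex embeddings\<close>

text \<open>Both differences have the same size, so a bijection pairs each element of
  \<open>T - S\<close> with a heavier one of \<open>S - T\<close>; the common part cancels.\<close>

lemma sum_less_sum_if_separated:
  fixes w :: "'v \<Rightarrow> real"
  assumes "finite S" "finite T" "card S = card T" "S \<noteq> T"
    and less: "\<And>s t. s \<in> S \<Longrightarrow> t \<in> T - S \<Longrightarrow> w t < w s"
  shows "sum w T < sum w S"
proof -
  have "card (S - T) = card (T - S)"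
    using card_Diff_subset_Int[of S T] card_Diff_subset_Int[of T S] assms(1-3)
    by (simp add: Int_commute)
  then obtain g where g: "bij_betw g (T - S) (S - T)"
    using assms(1,2) finite_same_card_bij by (metis finite_Diff)
  have "T - S \<noteq> {}" using assms(1-4) by (metis Diff_eq_empty_iff card_subset_eq)
  then have "sum w (T - S) < (\<Sum>t\<in>T - S. w (g t))"
    using assms(2) g less by (intro sum_strict_mono) (auto simp: bij_betw_def)
  also have "\<dots> = sum w (S - T)" using g by (rule sum.reindex_bij_betw)
  finally have "sum w (T - S) + sum w (S \<inter> T) < sum w (S - T) + sum w (S \<inter> T)" by simp
  then show ?thesis
    using sum.Int_Diff[of S w T] sum.Int_Diff[of T w S] assms(1,2)
    by (simp add: Int_commute add.commute)
qed

text \<open>A functional that is larger on \<open>S\<close> than off it attains its strict maximum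
  over all barycenters at that of \<open>S\<close>, which therefore lies outside the convex hull of
  the others.\<close>

lemma convex_embedding_if_separated:
  assumes V: "finite V" and k: "0 < k" "k < card V" and Rn: "f ` V \<subseteq> Rn d"
    and sep: "\<And>S. S \<in> [V]\<^bsup>k\<^esup> \<Longrightarrow>
      \<exists>h::(nat \<Rightarrow>\<^sub>0 real) \<Rightarrow> real. linear h \<and> (\<forall>s\<in>S. \<forall>t\<in>V - S. h (f t) < h (f s))"
  shows "convex_embedding k (V, [V]\<^bsup>k\<^esup>) d f"
proof -
  define p where "p e = (1 / real k) *\<^sub>R (\<Sum>v\<in>e. f v)" for e
  have sep': "\<exists>h::(nat \<Rightarrow>\<^sub>0 real) \<Rightarrow> real. linear h \<and> (\<forall>T\<in>[V]\<^bsup>k\<^esup> - {S}. h (p T) < h (p S))" if S: "S \<in> [V]\<^bsup>k\<^esup>" for S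
  proof -
    obtain h :: "(nat \<Rightarrow>\<^sub>0 real) \<Rightarrow> real"
      where h: "linear h" and less: "\<And>s t. s \<in> S \<Longrightarrow> t \<in> V - S \<Longrightarrow> h (f t) < h (f s)"
      using sep[OF S] by blast
    have hp: "h (p T) = (1 / real k) * (\<Sum>v\<in>T. h (f v))" for T
      using h by (simp add: p_def linear_cmul linear_sum sum_divide_distrib)
    have "h (p T) < h (p S)" if T: "T \<in> [V]\<^bsup>k\<^esup> - {S}" for T
    proof -
      have "(\<Sum>v\<in>T. h (f v)) < (\<Sum>v\<in>S. h (f v))"
        using S T by (intro sum_less_sum_if_separated less) (auto simp: nsets_def)
      then show ?thesis unfolding hp using k by (simp add: divide_strict_right_mono)
    qed
    then show ?thesis using h by blast
  qed
  have "inj_on p ([V]\<^bsup>k\<^esup>)"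
  proof (rule inj_onI, rule ccontr)
    fix S T assume "S \<in> [V]\<^bsup>k\<^esup>" "T \<in> [V]\<^bsup>k\<^esup>" "p S = p T" "S \<noteq> T"
    then show False using sep'[of S] by (metis Diff_iff singletonD less_irrefl)
  qed
  moreover have "p S \<notin> convex hull (p ` ([V]\<^bsup>k\<^esup> - {S}))" if S: "S \<in> [V]\<^bsup>k\<^esup>" for S
  proof
    obtain h :: "(nat \<Rightarrow>\<^sub>0 real) \<Rightarrow> real"
      where h: "linear h" and less: "\<And>T. T \<in> [V]\<^bsup>k\<^esup> - {S} \<Longrightarrow> h (p T) < h (p S)"
      using sep'[OF S] by blast
    have "convex (h -` {..< h (p S)})" using h by (intro convex_linear_vimage) auto
    then have "convex hull (p ` ([V]\<^bsup>k\<^esup> - {S})) \<subseteq> h -` {..< h (p S)}"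
      using less by (intro hull_minimal) auto
    moreover assume "p S \<in> convex hull (p ` ([V]\<^bsup>k\<^esup> - {S}))"
    ultimately show False by auto
  qed
  moreover have "inj_on f V"
  proof (rule inj_onI, rule ccontr)
    fix v w assume vw: "v \<in> V" "w \<in> V" "f v = f w" "v \<noteq> w"
    \<comment> \<open>Since \<open>0 < k < card V\<close>, some \<open>k\<close>-set contains
      \<open>v\<close> and avoids \<open>w\<close>; its functional tells their images apart.\<close>
    then have "card {v} \<le> k" "k \<le> card (V - {w})" "{v} \<subseteq> V - {w}" "finite (V - {w})"
      using V k by auto
    then obtain S where S: "{v} \<subseteq> S" "S \<subseteq> V - {w}" "card S = k"
      using exists_subset_between by metis
    then have "S \<in> [V]\<^bsup>k\<^esup>"
      using V finite_subset[of S V] by (auto simp: nsets_def)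
    from sep[OF this] obtain h :: "(nat \<Rightarrow>\<^sub>0 real) \<Rightarrow> real"
      where "\<forall>s\<in>S. \<forall>t\<in>V - S. h (f t) < h (f s)" by blast
    moreover have "v \<in> S" "w \<in> V - S" using S vw by auto
    ultimately have "h (f w) < h (f v)" by blast
    then show False using vw by simp
  qed
  ultimately show ?thesis using Rn by (simp add: convex_position_def p_def[abs_def])
qed

section \<open>Explicit embeddings: moment curve and centered simplex\<close>

lemma linear_lookup_combination:
  "linear (\<lambda>x::nat \<Rightarrow>\<^sub>0 real. \<Sum>i<d. c i * Poly_Mapping.lookup x i)"
  by (rule linearI)
    (simp_all add: lookup_add lookup_scaleR algebra_simps sum.distrib sum_distrib_left)

definition vec :: "nat \<Rightarrow> (nat \<Rightarrow> real) \<Rightarrow> (nat \<Rightarrow>\<^sub>0 real)" where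
  "vec d x = (\<Sum>i<d. Poly_Mapping.single i (x i))"

lemma lookup_vec: "Poly_Mapping.lookup (vec d x) j = (if j < d then x j else 0)"
  by (simp add: vec_def lookup_sum lookup_single when_def)

lemma vec_in_Rn: "vec d x \<in> Rn d"
  by (simp add: Rn_def lookup_vec)

lemma separated_by_combination:
  assumes "\<And>s t. s \<in> S \<Longrightarrow> t \<in> T \<Longrightarrow> (\<Sum>i<d. c i * x t i) < (\<Sum>i<d. c i * x s i)"
  shows "\<exists>h::(nat \<Rightarrow>\<^sub>0 real) \<Rightarrow> real.
    linear h \<and> (\<forall>s\<in>S. \<forall>t\<in>T. h (vec d (x t)) < h (vec d (x s)))"
  using assms
  by (intro exI[of _ "\<lambda>x. \<Sum>i<d. c i * Poly_Mapping.lookup x i"] conjI linear_lookup_combination)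
    (simp add: lookup_vec)

text \<open>
  For a set \<open>A\<close> of at most \<open>m\<close> parameters, the square of the polynomial vanishing on \<open>A\<close>
  is a functional on the moment curve that is minimal precisely at \<open>A\<close>.
\<close>

lemma moment_curve_functional:
  fixes A :: "nat set"
  assumes "finite A" "card A \<le> m"
  shows "\<exists>c b. \<forall>t::nat. (\<Sum>i<2*m. c i * real t ^ Suc i) + b = (\<Prod>a\<in>A. (real t - real a)\<^sup>2)"
proof -
  define q where "q = (\<Prod>a\<in>A. [:- real a, 1:]) ^ 2"
  have "degree (\<Prod>a\<in>A. [:- real a, 1:]) \<le> card A"
    using degree_prod_sum_le[OF assms(1), of "\<lambda>a. [:- real a, 1:]"] by simp
  then have "degree q \<le> 2 * m"
    using assms(2) degree_power_le[of "\<Prod>a\<in>A. [:- real a, 1:]" 2] unfolding q_def by linarith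
  then have "poly q x = (\<Sum>i\<le>2*m. coeff q i * x ^ i)" for x
    unfolding poly_altdef by (intro sum.mono_neutral_left) (auto simp: coeff_eq_0)
  also have "\<dots> x = coeff q 0 + (\<Sum>i<2*m. coeff q (Suc i) * x ^ Suc i)" for x
    unfolding lessThan_Suc_atMost[symmetric] sum.lessThan_Suc_shift by simp
  finally have "poly q x = coeff q 0 + (\<Sum>i<2*m. coeff q (Suc i) * x ^ Suc i)" for x .
  moreover have "poly q (real t) = (\<Prod>a\<in>A. (real t - real a)\<^sup>2)" for t
    by (simp add: q_def poly_prod prod_power_distrib)
  ultimately have "(\<Sum>i<2*m. coeff q (Suc i) * real t ^ Suc i) + coeff q 0
      = (\<Prod>a\<in>A. (real t - real a)\<^sup>2)" for t
    by (metis add.commute)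
  then show ?thesis by (intro exI allI)
qed

text \<open>Either \<open>S\<close> or its complement has \<open>m\<close> elements. The squared
  polynomial vanishing on that set is positive at all other vertices, so up to sign it separates.
  Its constant term \<open>b\<close> cancels when two values are compared.\<close>

lemma moment_curve_embedding:
  assumes "0 < k" "k < n" "m = k \<or> m = n - k"
  shows "\<exists>f. convex_embedding k (complete_hypergraph n k) (2 * m) f"
proof -
  define x where "x v i = real v ^ Suc i" for v i :: nat
  have sep: "\<exists>h::(nat \<Rightarrow>\<^sub>0 real) \<Rightarrow> real. linear h \<and>
      (\<forall>s\<in>S. \<forall>t\<in>{1..n} - S. h (vec (2 * m) (x t)) < h (vec (2 * m) (x s)))"
    if S: "S \<in> [{1..n}]\<^bsup>k\<^esup>" for S
  proof -
    have S': "finite S" "S \<subseteq> {1..n}" "card S = k" using S by (auto simp: nsets_def)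
    have pos: "(\<Prod>a\<in>A. (real t - real a)\<^sup>2) > 0" if "t \<notin> A" for A t
      using that by (intro prod_pos) auto
    have zero: "(\<Prod>a\<in>A. (real t - real a)\<^sup>2) = 0" if "t \<in> A" "finite A" for A t
      using that by (auto simp: prod_zero_iff)
    show ?thesis
    proof (cases "m = k")
      case True
      then obtain c b where
        cb: "\<And>t. (\<Sum>i<2*m. c i * real t ^ Suc i) + b = (\<Prod>a\<in>S. (real t - real a)\<^sup>2)"
        using moment_curve_functional[of S m] S' by auto
      \<comment> \<open>Here the polynomial vanishes on \<open>S\<close> itself, hence the sign
        change.\<close>
      have "(\<Sum>i<2*m. - c i * x t i) < (\<Sum>i<2*m. - c i * x s i)"
        if "s \<in> S" "t \<in> {1..n} - S" for s t
        using cb[of s] cb[of t] pos[of t S] zero[OF that(1) S'(1)] that by (simp add: x_def sum_negf)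
      then show ?thesis by (rule separated_by_combination)
    next
      case False
      then have "card ({1..n} - S) = m" using S' assms(3) by (simp add: card_Diff_subset)
      then obtain c b where
        cb: "\<And>t. (\<Sum>i<2*m. c i * real t ^ Suc i) + b = (\<Prod>a\<in>{1..n} - S. (real t - real a)\<^sup>2)"
        using moment_curve_functional[of "{1..n} - S" m] by auto
      have "(\<Sum>i<2*m. c i * x t i) < (\<Sum>i<2*m. c i * x s i)"
        if "s \<in> S" "t \<in> {1..n} - S" for s t
      proof -
        have "(\<Sum>i<2*m. c i * real t ^ Suc i) + b < (\<Sum>i<2*m. c i * real s ^ Suc i) + b"
          unfolding cb zero[OF that(2) finite_Diff[OF finite_atLeastAtMost]]
          by (rule pos) (use that in simp)
        then show ?thesis by (simp add: x_def)
      qed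
      then show ?thesis by (rule separated_by_combination)
    qed
  qed
  show ?thesis
    unfolding complete_hypergraph_def
    using assms(1,2)
    by (intro exI[of _ "\<lambda>v. vec (2 * m) (x v)"] convex_embedding_if_separated sep)
      (auto simp: vec_in_Rn)
qed

text \<open>The vertices of a simplex with the origin in its interior, together with the origin.\<close>

lemma centered_simplex_embedding:
  assumes "2 \<le> k" "k + 2 \<le> n"
  shows "\<exists>f. convex_embedding k (complete_hypergraph n k) (n - 2) f"
proof -
  \<comment> \<open>Vertices \<open>1\<close> to \<open>n - 2\<close> are the unit vectors,
    \<open>n - 1\<close> is minus their sum, and \<open>n\<close> is the origin.\<close>
  define x :: "nat \<Rightarrow> nat \<Rightarrow> real" where
    "x v i = (if v = n then 0 else if v = n - 1 then -1 else if Suc i = v then 1 else 0)" for v i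
  define M where "M = {1..n - 1}"
  have sep: "\<exists>h::(nat \<Rightarrow>\<^sub>0 real) \<Rightarrow> real. linear h \<and>
      (\<forall>s\<in>S. \<forall>t\<in>{1..n} - S. h (vec (n - 2) (x t)) < h (vec (n - 2) (x s)))"
    if S: "S \<in> [{1..n}]\<^bsup>k\<^esup>" for S
  proof -
    have S': "finite S" "S \<subseteq> {1..n}" "card S = k" using S by (auto simp: nsets_def)
    \<comment> \<open>The bounds \<open>2 \<le> k \<le> n - 2\<close> ensure that simplex vertices
      remain both inside and outside \<open>S\<close>, wherever the origin belongs.\<close>
    have MS: "M \<inter> S = S - {n}" using S' assms by (fastforce simp: M_def)
    then have "card S \<le> Suc (card (M \<inter> S))" "card (M \<inter> S) \<le> card S"
      using S' card_Suc_Diff1[of S n] by (cases "n \<in> S"; simp)+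
    then have "card (M \<inter> S) > 0" "card (M \<inter> S) < card M"
      using assms S' by (auto simp: M_def)
    moreover have "card (M - S) = card M - card (M \<inter> S)"
      by (rule card_Diff_subset_Int) (simp add: M_def)
    ultimately have pos: "card (M \<inter> S) > 0" "card (M - S) > 0" by simp_all
    \<comment> \<open>These are the prescribed values at the simplex vertices. Such values extend to
      a linear functional as soon as they sum to zero, because the vertices do. The origin gets
      value 0, strictly between the positive and the negative values, so it may lie on either
      side.\<close>
    define w where "w v = (if v \<in> S then 1 / real (card (M \<inter> S)) else - 1 / real (card (M - S)))" for v
    have "sum w M = sum w (M \<inter> S) + sum w (M - S)"
      by (rule sum.Int_Diff) (simp add: M_def)
    also have "\<dots> = 0" using pos by (simp add: w_def)
    finally have "sum w M = 0" .
    moreover have "M = insert (n - 1) (Suc ` {..<n - 2})"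
      using assms by (auto simp: M_def image_Suc_lessThan)
    moreover have "n - 1 \<notin> Suc ` {..<n - 2}" using assms by auto
    ultimately have "(\<Sum>i<n - 2. w (Suc i)) = - w (n - 1)"
      by (simp add: sum.reindex)
    then have val: "(\<Sum>i<n - 2. w (Suc i) * x v i) = (if v = n then 0 else w v)" if "v \<in> {1..n}" for v
    proof -
      have "v = n \<or> v = n - 1 \<and> v \<noteq> n \<or> v - 1 < n - 2 \<and> Suc (v - 1) = v \<and> v \<noteq> n \<and> v \<noteq> n - 1"
        using that assms unfolding atLeastAtMost_iff by linarith
      then consider "v = n" | "v = n - 1" "v \<noteq> n"
        | "v - 1 < n - 2" "Suc (v - 1) = v" "v \<noteq> n" "v \<noteq> n - 1"
        by blast
      then show ?thesis
      proof cases
        case 3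
        have "(\<Sum>i<n - 2. w (Suc i) * x v i) = (\<Sum>i<n - 2. if i = v - 1 then w v else 0)"
          using 3 by (intro sum.cong refl) (auto simp: x_def)
        then show ?thesis using 3 by simp
      qed (use \<open>(\<Sum>i<n - 2. w (Suc i)) = - w (n - 1)\<close> in \<open>simp_all add: x_def sum_negf\<close>)
    qed
    have w: "s \<in> S \<Longrightarrow> w s > 0" "s \<notin> S \<Longrightarrow> w s < 0" for s
      using pos by (simp_all add: w_def)
    have "(\<Sum>i<n - 2. w (Suc i) * x t i) < (\<Sum>i<n - 2. w (Suc i) * x s i)"
      if st: "s \<in> S" "t \<in> {1..n} - S" for s t
    proof -
      have "s \<in> {1..n}" "t \<in> {1..n}" "t \<notin> S" "s \<noteq> t" using st S' by auto
      then show ?thesis using val w(1)[OF st(1)] w(2)[OF \<open>t \<notin> S\<close>] by auto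
    qed
    then show ?thesis by (rule separated_by_combination)
  qed
  show ?thesis
    unfolding complete_hypergraph_def
    using assms
    by (intro exI[of _ "\<lambda>v. vec (n - 2) (x v)"] convex_embedding_if_separated sep)
      (auto simp: vec_in_Rn)
qed

section \<open>Existence of dependencies with prescribed signs\<close>

text \<open>Elimination, by induction on the number of equations. Vanishing outside \<open>V\<close>
  lets a solution on \<open>V - {u}\<close> be reused on \<open>V\<close>.\<close>

lemma ex_nontrivial_solution:
  fixes a :: "nat \<Rightarrow> 'v \<Rightarrow> real"
  assumes "finite V" "m < card V"
  shows "\<exists>l. (\<exists>v\<in>V. l v \<noteq> 0) \<and> (\<forall>v. v \<notin> V \<longrightarrow> l v = 0) \<and> (\<forall>i<m. (\<Sum>v\<in>V. l v * a i v) = 0)"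
  using assms
proof (induction m arbitrary: V)
  case 0
  then obtain u where "u \<in> V" by fastforce
  then show ?case by (intro exI[of _ "\<lambda>v. if v = u then 1 else 0"]) auto
next
  case (Suc m)
  have sub: "\<exists>l. (\<exists>v\<in>V. l v \<noteq> 0) \<and> (\<forall>v. v \<notin> V - {u} \<longrightarrow> l v = 0) \<and> (\<forall>i<m. (\<Sum>v\<in>V. l v * a i v) = 0)"
    if u: "u \<in> V" for u
  proof -
    have "m < card (V - {u})" using Suc.prems u by simp
    then obtain l where l: "\<exists>v\<in>V - {u}. l v \<noteq> 0" "\<forall>v. v \<notin> V - {u} \<longrightarrow> l v = 0"
        "\<forall>i<m. (\<Sum>v\<in>V - {u}. l v * a i v) = 0"
      using Suc.IH[of "V - {u}"] Suc.prems(1) by auto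
    moreover have "(\<Sum>v\<in>V. l v * a i v) = (\<Sum>v\<in>V - {u}. l v * a i v)" for i
      using Suc.prems(1) l(2) by (intro sum.mono_neutral_right) auto
    ultimately show ?thesis by (intro exI[of _ l]) auto
  qed
  obtain u0 where "u0 \<in> V" using Suc.prems by fastforce
  then obtain l1 u where l1: "u \<in> V" "l1 u \<noteq> 0" "\<forall>v. v \<notin> V \<longrightarrow> l1 v = 0"
      "\<forall>i<m. (\<Sum>v\<in>V. l1 v * a i v) = 0"
    using sub[of u0] by auto
  obtain l2 where l2: "\<exists>v\<in>V. l2 v \<noteq> 0" "\<forall>v. v \<notin> V - {u} \<longrightarrow> l2 v = 0"
      "\<forall>i<m. (\<Sum>v\<in>V. l2 v * a i v) = 0"
    using sub[OF l1(1)] by auto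
  define s where "s l = (\<Sum>v\<in>V. l v * a m v)" for l
  show ?case
  proof (cases "s l2 = 0")
    case True
    then show ?thesis using l2 by (intro exI[of _ l2]) (auto simp: less_Suc_eq s_def)
  next
    case False
    \<comment> \<open>The coefficient makes equation \<open>m\<close> hold, and since
      \<open>l2 u = 0\<close> the entry at \<open>u\<close> remains \<open>l1 u\<close>, which is
      nonzero.\<close>
    define l where "l v = l1 v - s l1 / s l2 * l2 v" for v
    have "(\<Sum>v\<in>V. l v * a i v) = (\<Sum>v\<in>V. l1 v * a i v) - s l1 / s l2 * (\<Sum>v\<in>V. l2 v * a i v)" for i
      unfolding l_def sum_distrib_left sum_subtractf[symmetric] by (simp add: algebra_simps)
    then have "\<forall>i<Suc m. (\<Sum>v\<in>V. l v * a i v) = 0"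
      using l1(4) l2(3) False by (auto simp: less_Suc_eq s_def)
    moreover have "l u \<noteq> 0" using l1(2) l2(2) by (simp add: l_def)
    ultimately show ?thesis using l1(1,3) l2(2) by (intro exI[of _ l]) (auto simp: l_def)
  qed
qed

lemma lookup_combination:
  "Poly_Mapping.lookup (\<Sum>v\<in>V. l v *\<^sub>R f v) i = (\<Sum>v\<in>V. l v * Poly_Mapping.lookup (f v) i)"
  for f :: "'v \<Rightarrow> (nat \<Rightarrow>\<^sub>0 real)"
  by (simp add: lookup_sum lookup_scaleR)

lemma ex_dependency:
  fixes b :: "nat \<Rightarrow> 'v \<Rightarrow> real"
  assumes V: "finite V" and f: "f ` V \<subseteq> Rn d" and card: "d + e + 1 < card V"
  shows "\<exists>l. (\<exists>v\<in>V. l v \<noteq> 0) \<and> sum l V = 0 \<and> (\<Sum>v\<in>V. l v *\<^sub>R f v) = 0 \<and>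
    (\<forall>j<e. (\<Sum>v\<in>V. l v * b j v) = 0)"
proof -
  \<comment> \<open>Rows below \<open>d\<close> express the coordinates, row \<open>d\<close> the
    vanishing of the coefficient sum, and the remaining \<open>e\<close> rows the extra conditions
    \<open>b\<close>.\<close>
  define a where "a i v =
    (if i < d then Poly_Mapping.lookup (f v) i else if i = d then 1 else b (i - Suc d) v)" for i v
  obtain l where l: "\<exists>v\<in>V. l v \<noteq> 0" "\<And>i. i < d + e + 1 \<Longrightarrow> (\<Sum>v\<in>V. l v * a i v) = 0"
    using ex_nontrivial_solution[OF V card, of a] by auto
  have "Poly_Mapping.lookup (\<Sum>v\<in>V. l v *\<^sub>R f v) i = 0" for i
  proof (cases "i < d")
    case True
    then show ?thesis using l(2)[of i] by (simp add: lookup_combination a_def)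
  next
    case False
    then have "Poly_Mapping.lookup (f v) i = 0" if "v \<in> V" for v
      using f that by (auto simp: Rn_def)
    then show ?thesis by (simp add: lookup_combination)
  qed
  then have "(\<Sum>v\<in>V. l v *\<^sub>R f v) = 0" by (intro poly_mapping_eqI) simp
  moreover have "(\<Sum>v\<in>V. l v * b j v) = 0" if "j < e" for j
    using l(2)[of "Suc d + j"] that by (simp add: a_def)
  ultimately show ?thesis using l(1) l(2)[of d] by (auto simp: a_def)
qed

text \<open>The condition is a union, over the subsets \<open>T\<close> with at least
  \<open>m\<close> elements, of finite intersections of open sets.\<close>

lemma open_card_ge:
  fixes F :: "'v \<Rightarrow> real \<Rightarrow> real"
  assumes "finite V" "\<And>v. continuous_on UNIV (F v)"
  shows "open {t. m \<le> card {v\<in>V. F v t > 0}}"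
proof -
  have "{t. m \<le> card {v\<in>V. F v t > 0}} = (\<Union>T\<in>{T. T \<subseteq> V \<and> m \<le> card T}. \<Inter>v\<in>T. {t. F v t > 0})"
  proof (intro set_eqI iffI)
    fix t assume "t \<in> {t. m \<le> card {v\<in>V. F v t > 0}}"
    then show "t \<in> (\<Union>T\<in>{T. T \<subseteq> V \<and> m \<le> card T}. \<Inter>v\<in>T. {t. F v t > 0})"
      by (intro UN_I[of "{v\<in>V. F v t > 0}"]) auto
  next
    fix t assume "t \<in> (\<Union>T\<in>{T. T \<subseteq> V \<and> m \<le> card T}. \<Inter>v\<in>T. {t. F v t > 0})"
    then obtain T where "T \<subseteq> {v\<in>V. F v t > 0}" "m \<le> card T" by blast
    moreover have "finite {v\<in>V. F v t > 0}" using assms(1) by simp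
    ultimately show "t \<in> {t. m \<le> card {v\<in>V. F v t > 0}}"
      using card_mono[of "{v\<in>V. F v t > 0}" T] by simp
  qed
  moreover have "open (\<Inter>v\<in>T. {t. F v t > 0})" if "T \<subseteq> V" for T
    using finite_subset[OF that assms(1)] assms(2)
    by (intro open_INT ballI open_Collect_less continuous_on_const)
  ultimately show ?thesis by (simp add: open_UN)
qed

text \<open>
  Two independent dependencies span a circle of dependencies, which is connected and on which
  the antipodal map exchanges positive and negative entries. If no dependency had the required
  signs, the circle would be covered by three disjoint open sets of sign patterns: many
  positive entries, many negative entries, or neither. Antipodality leaves only the last one,
  on which no entry vanishes; but some dependency on the circle vanishes at \<open>u\<close>.
\<close>

lemma ex_balanced_dependency:
  assumes V: "finite V" and f: "f ` V \<subseteq> Rn d" and d: "d + 3 \<le> card V"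
    and k: "2 * k \<le> card V" "card V \<le> 2 * k + 2"
  shows "\<exists>l. (\<exists>v\<in>V. l v \<noteq> 0) \<and> sum l V = 0 \<and> (\<Sum>v\<in>V. l v *\<^sub>R f v) = 0 \<and>
    card {v\<in>V. l v > 0} \<le> k \<and> card {v\<in>V. l v < 0} + k \<le> card V"
proof (rule ccontr)
  assume contra: "\<not> ?thesis"
  obtain l u where l: "u \<in> V" "l u \<noteq> 0" "sum l V = 0" "(\<Sum>v\<in>V. l v *\<^sub>R f v) = 0"
    using ex_dependency[OF V f, of 0] d by auto
  \<comment> \<open>The extra equation forces \<open>m u = 0\<close>, which makes \<open>m\<close>
    independent of \<open>l\<close>. Dimension at most \<open>card V - 3\<close> leaves room for
    it.\<close>
  obtain m where m: "\<exists>v\<in>V. m v \<noteq> 0" "sum m V = 0" "(\<Sum>v\<in>V. m v *\<^sub>R f v) = 0"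
    and "(\<Sum>v\<in>V. m v * (if v = u then 1 else 0)) = 0"
    using ex_dependency[OF V f, of 1 "\<lambda>_ v. if v = u then 1 else 0"] d by auto
  then have mu: "m u = 0" using V l(1) by (simp add: if_distrib cong: if_cong)
  define F where "F v t = cos t * l v + sin t * m v" for v and t :: real
  define G where "G v t = - F v t" for v t
  have contF: "continuous_on UNIV (F v)" and contG: "continuous_on UNIV (G v)" for v
    unfolding F_def G_def by (intro continuous_intros)+
  have comb: "(\<Sum>v\<in>V. F v t) = 0" "(\<Sum>v\<in>V. F v t *\<^sub>R f v) = 0" for t
  proof -
    have "(\<Sum>v\<in>V. F v t) = cos t * sum l V + sin t * sum m V"
      by (simp add: F_def sum.distrib sum_distrib_left)
    then show "(\<Sum>v\<in>V. F v t) = 0" using l m by simp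
    have "(\<Sum>v\<in>V. F v t *\<^sub>R f v) = cos t *\<^sub>R (\<Sum>v\<in>V. l v *\<^sub>R f v) + sin t *\<^sub>R (\<Sum>v\<in>V. m v *\<^sub>R f v)"
      by (simp add: F_def sum.distrib scaleR_sum_right scaleR_add_left)
    then show "(\<Sum>v\<in>V. F v t *\<^sub>R f v) = 0" using l m by simp
  qed
  have Fnz: "\<exists>v\<in>V. F v t \<noteq> 0" for t
  proof (cases "cos t = 0")
    case True
    then have "sin t \<noteq> 0" using sin_cos_squared_add[of t] by auto
    then show ?thesis using True m(1) by (auto simp: F_def)
  next
    case False
    then show ?thesis using l(1,2) mu by (intro bexI[of _ u]) (simp_all add: F_def)
  qed
  define P where "P t = card {v\<in>V. F v t > 0}" for t
  define N where "N t = card {v\<in>V. G v t > 0}" for t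
  have anti: "P (t + pi) = N t" "N (t + pi) = P t" for t
    by (simp_all add: P_def N_def G_def F_def add.commute)
  have PN: "P t + N t = card {v\<in>V. F v t \<noteq> 0}" for t
  proof -
    have "{v\<in>V. F v t \<noteq> 0} = {v\<in>V. F v t > 0} \<union> {v\<in>V. G v t > 0}" by (auto simp: G_def)
    moreover have "card ({v\<in>V. F v t > 0} \<union> {v\<in>V. G v t > 0}) = P t + N t"
      unfolding P_def N_def using V by (intro card_Un_disjoint) (auto simp: G_def)
    ultimately show ?thesis by simp
  qed
  have PN_le: "P t + N t \<le> card V" for t
    unfolding PN using V by (intro card_mono) auto
  have "P t > k \<or> N t + k > card V" for t
  proof (rule ccontr)
    assume *: "\<not> (P t > k \<or> N t + k > card V)"
    have "\<exists>v\<in>V. F v t \<noteq> 0" "card {v\<in>V. F v t > 0} \<le> k" "card {v\<in>V. F v t < 0} + k \<le> card V"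
      using Fnz * by (auto simp: P_def N_def G_def not_less)
    then show False
      using comb[of t] contra[unfolded not_ex, THEN spec, of "\<lambda>v. F v t"] by blast
  qed
  \<comment> \<open>The second conjunct is the first one at the antipode
    \<open>t + pi\<close>.\<close>
  then have trichotomy: "(P t > k \<or> N t + k > card V) \<and> (N t > k \<or> P t + k > card V)" for t
    using anti by metis
  \<comment> \<open>\<open>U\<close> is the pattern with many positive entries; \<open>W\<close>
    joins the other two. They are disjoint because \<open>P t + N t \<le> card V\<close> and
    \<open>2 * k \<le> card V\<close>.\<close>
  define U where "U = {t. Suc (card V - k) \<le> P t}"
  define W where "W = {t. Suc (card V - k) \<le> N t} \<union> ({t. Suc k \<le> P t} \<inter> {t. Suc k \<le> N t})"
  have "open U" "open W"
    unfolding U_def W_def P_def N_def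
    by (intro open_Un open_Int open_card_ge V contF contG)+
  moreover have UW: "t \<in> U \<or> t \<in> W" for t
    using trichotomy[of t] k by (auto simp: U_def W_def)
  moreover have disj: "t \<notin> U \<or> t \<notin> W" for t
    using PN_le[of t] k by (auto simp: U_def W_def)
  ultimately have "U = {} \<or> W = {}"
    using connectedD[OF connected_UNIV, of U W] by blast
  moreover have "t + pi \<in> W" if "t \<in> U" for t
    using that anti by (auto simp: U_def W_def)
  ultimately have "U = {}" by blast
  then have "t \<notin> U" for t by blast
  then have "P t \<le> card V - k" for t by (simp add: U_def not_le less_Suc_eq_le)
  \<comment> \<open>At \<open>pi / 2\<close> the dependency is \<open>m\<close>, which vanishes at
    \<open>u\<close>. So at most \<open>card V - 1 \<le> 2 * k + 1\<close> entries are nonzero,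
    although more than \<open>k\<close> are positive and more than \<open>k\<close>
    negative.\<close>
  from this[of "pi / 2"] this[of "pi / 2 + pi"] have "P (pi / 2) > k" "N (pi / 2) > k"
    using trichotomy[of "pi / 2"] k unfolding anti by linarith+
  moreover have "P (pi / 2) + N (pi / 2) < card V"
    unfolding PN using V l(1) mu by (intro psubset_card_mono) (auto simp: F_def)
  ultimately show False using k by linarith
qed

text \<open>Coefficients with sum zero cannot all be positive or all negative, and among three of
  them one sign occurs at most once; negate if it is the negative one. This serves
  \<open>n = 3\<close>, where the circle argument yields only \<open>1 \<le> d\<close>.\<close>

lemma ex_signed_dependency_on_line:
  assumes V: "card V = 3" and f: "f ` V \<subseteq> Rn d" and d: "d \<le> 1"
  shows "\<exists>l. (\<exists>v\<in>V. l v \<noteq> 0) \<and> sum l V = 0 \<and> (\<Sum>v\<in>V. l v *\<^sub>R f v) = 0 \<and>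
    card {v\<in>V. l v > 0} \<le> 1 \<and> card {v\<in>V. l v < 0} + 1 \<le> card V"
proof -
  have fin: "finite V" using V by (auto intro: card_ge_0_finite)
  obtain l where l: "\<exists>v\<in>V. l v \<noteq> 0" "sum l V = 0" "(\<Sum>v\<in>V. l v *\<^sub>R f v) = 0"
    using ex_dependency[OF fin f, of 0] V d by auto
  have le2: "card {v\<in>V. g v > 0} \<le> 2" if "sum g V = 0" for g :: "_ \<Rightarrow> real"
  proof -
    have "{v\<in>V. g v > 0} \<noteq> V"
    proof
      assume "{v\<in>V. g v > 0} = V"
      then have "sum g V > 0" using V fin by (intro sum_pos) auto
      then show False using that by simp
    qed
    then have "card {v\<in>V. g v > 0} < card V" using fin by (intro psubset_card_mono) auto
    then show ?thesis using V by simp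
  qed
  have le: "card {v\<in>V. l v > 0} \<le> 2" "card {v\<in>V. l v < 0} \<le> 2"
    using le2[of l] le2[of "\<lambda>v. - l v"] l(2) by (simp_all add: sum_negf)
  have "card {v\<in>V. l v > 0} + card {v\<in>V. l v < 0} = card ({v\<in>V. l v > 0} \<union> {v\<in>V. l v < 0})"
    using fin by (intro card_Un_disjoint[symmetric]) auto
  also have "\<dots> \<le> card V" using fin by (intro card_mono) auto
  finally consider "card {v\<in>V. l v > 0} \<le> 1" | "card {v\<in>V. l v < 0} \<le> 1" using V by linarith
  then show ?thesis
  proof cases
    case 1
    then show ?thesis using l le V by (intro exI[of _ l]) simp
  next
    case 2
    then show ?thesis using l le V by (intro exI[of _ "\<lambda>v. - l v"]) (simp add: sum_negf)
  qed
qed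

section \<open>Lower bounds on the dimension\<close>

text \<open>A dependency on some of the vertices extends by zero to all of them. For
  \<open>a = n - k\<close> its negative has the signs required for \<open>k\<close>.\<close>

lemma not_convex_embedding_if_dependency:
  assumes W: "W \<subseteq> {1..n}" and k: "k \<le> n" and a: "a = k \<or> a = n - k"
    and l: "(\<exists>v\<in>W. l v \<noteq> 0) \<and> sum l W = 0 \<and> (\<Sum>v\<in>W. l v *\<^sub>R f v) = 0 \<and>
      card {v\<in>W. l v > 0} \<le> a \<and> card {v\<in>W. l v < 0} + a \<le> card W"
  shows "\<not> convex_embedding k (complete_hypergraph n k) d f"
proof -
  define L where "L v = (if v \<in> W then l v else 0)" for v
  have sum: "(\<Sum>v\<in>{1..n}. L v) = 0" "(\<Sum>v\<in>{1..n}. L v *\<^sub>R f v) = 0"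
  proof -
    have "(\<Sum>v\<in>{1..n}. L v) = sum l W"
      using W by (intro sum.mono_neutral_cong_right) (auto simp: L_def)
    moreover have "(\<Sum>v\<in>{1..n}. L v *\<^sub>R f v) = (\<Sum>v\<in>W. l v *\<^sub>R f v)"
      using W by (intro sum.mono_neutral_cong_right) (auto simp: L_def)
    ultimately show "(\<Sum>v\<in>{1..n}. L v) = 0" "(\<Sum>v\<in>{1..n}. L v *\<^sub>R f v) = 0" using l by simp_all
  qed
  have "{v\<in>{1..n}. L v > 0} = {v\<in>W. l v > 0}" "{v\<in>{1..n}. L v < 0} = {v\<in>W. l v < 0}"
    using W by (auto simp: L_def)
  moreover have "card W \<le> n" using W card_mono[of "{1..n}" W] by simp
  ultimately have card: "card {v\<in>{1..n}. L v > 0} \<le> a" "card {v\<in>{1..n}. L v < 0} + a \<le> n"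
    using l by simp_all
  have nz: "\<exists>v\<in>{1..n}. L v \<noteq> 0" using l W by (auto simp: L_def)
  have "\<not> convex_position (\<lambda>e. (1 / real k) *\<^sub>R (\<Sum>v\<in>e. f v)) ([{1..n}]\<^bsup>k\<^esup>)"
  proof (cases "a = k")
    case True
    then show ?thesis
      using sum nz card by (intro not_convex_position_if_dependency[of _ L]) auto
  next
    case False
    then show ?thesis
      using sum nz card a k
      by (intro not_convex_position_if_dependency[of _ "\<lambda>v. - L v"]) (auto simp: sum_negf)
  qed
  then show ?thesis by (simp add: complete_hypergraph_def)
qed

text \<open>Only the first \<open>w\<close> vertices are used, so \<open>w\<close> can be chosen as
  large as \<open>n\<close> and \<open>2 * a + 2\<close> permit.\<close>

lemma convex_embedding_dim_ge:
  assumes emb: "convex_embedding k (complete_hypergraph n k) d f"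
    and k: "k \<le> n" "a = k \<or> a = n - k"
    and w: "2 * a \<le> w" "w \<le> 2 * a + 2" "w \<le> n"
  shows "w \<le> d + 2"
proof (rule ccontr)
  assume "\<not> w \<le> d + 2"
  then have d: "d + 3 \<le> card {1..w}" by simp
  have W: "{1..w} \<subseteq> {1..n}" using w by auto
  have "f ` {1..w} \<subseteq> Rn d" using emb W by (auto simp: complete_hypergraph_def)
  then obtain l where "(\<exists>v\<in>{1..w}. l v \<noteq> 0) \<and> sum l {1..w} = 0 \<and>
      (\<Sum>v\<in>{1..w}. l v *\<^sub>R f v) = 0 \<and>
      card {v\<in>{1..w}. l v > 0} \<le> a \<and> card {v\<in>{1..w}. l v < 0} + a \<le> card {1..w}"
    using ex_balanced_dependency[OF _ _ d, of f a] w by auto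
  from not_convex_embedding_if_dependency[OF W k this, of d] emb show False by blast
qed

lemma convex_embedding_dim_ge_2:
  assumes emb: "convex_embedding k (complete_hypergraph n k) d f"
    and k: "k \<le> n" "1 = k \<or> 1 = n - k" and n: "3 \<le> n"
  shows "2 \<le> d"
proof (rule ccontr)
  assume "\<not> 2 \<le> d"
  then have d: "d \<le> 1" by simp
  have W: "{1..3::nat} \<subseteq> {1..n}" using n by auto
  have "f ` {1..3::nat} \<subseteq> Rn d" using emb W by (auto simp: complete_hypergraph_def)
  then obtain l where "(\<exists>v\<in>{1..3::nat}. l v \<noteq> 0) \<and> sum l {1..3::nat} = 0 \<and>
      (\<Sum>v\<in>{1..3::nat}. l v *\<^sub>R f v) = 0 \<and>
      card {v\<in>{1..3::nat}. l v > 0} \<le> 1 \<and> card {v\<in>{1..3::nat}. l v < 0} + 1 \<le> card {1..3::nat}"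
    using ex_signed_dependency_on_line[of "{1..3::nat}" f d] d by auto
  from not_convex_embedding_if_dependency[OF W k this, of d] emb show False by blast
qed

section \<open>Values of the convex dimension\<close>

lemma convex_dimension_eqI:
  assumes "\<exists>f. convex_embedding k H D f" "\<And>d f. convex_embedding k H d f \<Longrightarrow> D \<le> d"
  shows "convex_dimension k H = D"
  unfolding convex_dimension_def using assms by (intro Least_equality) auto

text \<open>The moment curve would give dimension 2; here the points 1 and 2 of the line suffice. In
  dimension 0 injectivity fails, as \<open>Rn 0\<close> is a single point.\<close>

lemma convex_dimension_two_points: "convex_dimension 1 (complete_hypergraph 2 1) = 1"
proof (rule convex_dimension_eqI)
  define x :: "nat \<Rightarrow> nat \<Rightarrow> real" where "x v i = real v" for v i
  have sep: "\<exists>h::(nat \<Rightarrow>\<^sub>0 real) \<Rightarrow> real. linear h \<and>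
      (\<forall>s\<in>S. \<forall>t\<in>{1..2} - S. h (vec 1 (x t)) < h (vec 1 (x s)))"
    if "S \<in> [{1..2}]\<^bsup>1\<^esup>" for S
  proof -
    have "S \<subseteq> {1..2}" "card S = 1" using that unfolding nsets_def by blast+
    then obtain s where "S = {s}" "s \<in> {1..2}" by (metis card_1_singletonE insert_subset)
    then show ?thesis
      by (intro separated_by_combination[where c = "\<lambda>_. if s = 1 then -1 else 1"]) (auto simp: x_def)
  qed
  show "\<exists>f. convex_embedding 1 (complete_hypergraph 2 1) 1 f"
    unfolding complete_hypergraph_def
    by (intro exI[of _ "\<lambda>v. vec 1 (x v)"] convex_embedding_if_separated sep)
      (auto simp: vec_in_Rn)
next
  fix d f
  assume emb: "convex_embedding 1 (complete_hypergraph 2 1) d f"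
  show "1 \<le> d"
  proof (rule ccontr)
    assume "\<not> 1 \<le> d"
    then have "f v = 0" if "v \<in> {1..2}" for v
      using emb that
      by (intro poly_mapping_eqI) (auto simp: complete_hypergraph_def Rn_def image_subset_iff)
    then have "f 1 = f 2" by simp
    moreover have "inj_on f {1..2}" using emb by (simp add: complete_hypergraph_def)
    ultimately show False by (auto dest: inj_onD)
  qed
qed

theorem theorem1p1:
  shows "(\<forall>n k::nat. 2 \<le> k \<and> k + 2 \<le> n \<longrightarrow>
            (n \<ge> 2 * k + 2 \<longrightarrow> convex_dimension k (complete_hypergraph n k) = 2 * k) \<and>
            (n \<in> {2 * k - 1, 2 * k, 2 * k + 1} \<longrightarrow>
               convex_dimension k (complete_hypergraph n k) = n - 2) \<and>
            (n \<le> 2 * k - 2 \<longrightarrow>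
               convex_dimension k (complete_hypergraph n k) = 2 * n - 2 * k)) \<and>
         convex_dimension 1 (complete_hypergraph 2 1) = 1 \<and>
         (\<forall>n::nat. n \<ge> 3 \<longrightarrow>
            convex_dimension 1 (complete_hypergraph n 1) = 2 \<and>
            convex_dimension (n - 1) (complete_hypergraph n (n - 1)) = 2)"
proof (intro conjI allI impI)
  fix n k :: nat
  assume k: "2 \<le> k \<and> k + 2 \<le> n"
  show "convex_dimension k (complete_hypergraph n k) = 2 * k" if n: "n \<ge> 2 * k + 2"
  proof (rule convex_dimension_eqI)
    show "\<exists>f. convex_embedding k (complete_hypergraph n k) (2 * k) f"
      using k by (intro moment_curve_embedding) auto
    show "2 * k \<le> d" if "convex_embedding k (complete_hypergraph n k) d f" for d f
      using convex_embedding_dim_ge[OF that, of k "2 * k + 2"] k n by simp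
  qed
  show "convex_dimension k (complete_hypergraph n k) = n - 2"
    if n: "n \<in> {2 * k - 1, 2 * k, 2 * k + 1}"
  proof (rule convex_dimension_eqI)
    show "\<exists>f. convex_embedding k (complete_hypergraph n k) (n - 2) f"
      using k by (intro centered_simplex_embedding) auto
    \<comment> \<open>For these three values of \<open>n\<close>, the smaller of \<open>k\<close>
      and \<open>n - k\<close> puts \<open>n\<close> itself into the admissible range from
      \<open>2 * a\<close> to \<open>2 * a + 2\<close>.\<close>
    define a where "a = min k (n - k)"
    have "2 * a \<le> n" "n \<le> 2 * a + 2" "a = k \<or> a = n - k"
      using n k by (auto simp: a_def min_def)
    then show "n - 2 \<le> d" if "convex_embedding k (complete_hypergraph n k) d f" for d f
      using convex_embedding_dim_ge[OF that, of a n] k by simp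
  qed
  show "convex_dimension k (complete_hypergraph n k) = 2 * n - 2 * k" if n: "n \<le> 2 * k - 2"
  proof (rule convex_dimension_eqI)
    show "\<exists>f. convex_embedding k (complete_hypergraph n k) (2 * n - 2 * k) f"
      using moment_curve_embedding[of k n "n - k"] k by (simp add: diff_mult_distrib2)
    \<comment> \<open>The mirror image of the first case, with \<open>n - k\<close> in the role of
      \<open>k\<close>.\<close>
    have "2 * (n - k) + 2 \<le> n" using n k by linarith
    then show "2 * n - 2 * k \<le> d" if "convex_embedding k (complete_hypergraph n k) d f" for d f
      using convex_embedding_dim_ge[OF that, of "n - k" "2 * (n - k) + 2"] k by (simp add: diff_mult_distrib2)
  qed
next
  fix n :: nat
  assume n: "n \<ge> 3"
  show "convex_dimension 1 (complete_hypergraph n 1) = 2"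
  proof (rule convex_dimension_eqI)
    show "\<exists>f. convex_embedding 1 (complete_hypergraph n 1) 2 f"
      using n moment_curve_embedding[of 1 n 1] by simp
    show "2 \<le> d" if "convex_embedding 1 (complete_hypergraph n 1) d f" for d f
      using convex_embedding_dim_ge_2[OF that] n by simp
  qed
  show "convex_dimension (n - 1) (complete_hypergraph n (n - 1)) = 2"
  proof (rule convex_dimension_eqI)
    show "\<exists>f. convex_embedding (n - 1) (complete_hypergraph n (n - 1)) 2 f"
      using n moment_curve_embedding[of "n - 1" n 1] by simp
    show "2 \<le> d" if "convex_embedding (n - 1) (complete_hypergraph n (n - 1)) d f" for d f
      using convex_embedding_dim_ge_2[OF that] n by simp
  qed
qed (rule convex_dimension_two_points)

end
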